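(* Let $A\subseteq B$ be an extension of unital associative algebras over a field $k$ such that $\dim_k(A)=n$ and $\dim_k(B)=n+m$, for two positive integers $m$ and $n$. Then there exists a canonical embedding (injective group homomorphism) $\mathrm{Gal}(B/A)\hookrightarrow \mathrm{GL}(m,k)\rtimes \mathrm{M}_{n\times m}(k)$, where $\mathrm{M}_{n\times m}(k)$ is the additive group of $(n\times m)$-matrices over $k$.
   Context: $k$ is an arbitrary field. $\mathrm{Gal}(B/A)$ is the group of all unital $k$-algebra automorphisms $\psi$ of $B$ with $\psi(a)=a$ for all $a\in A$. The semidirect product $\mathrm{GL}(m,k)\rtimes\mathrm{M}_{n\times m}(k)$ (written in the right hand side convention) is the set $\mathrm{M}_{n\times m}(k)\times\mathrm{GL}(m,k)$ with group law $(R,\Sigma)\cdot(R',\Sigma')=(R'+R\Sigma',\ \Sigma\Sigma')$. The canonical embedding is the following one. Fix a vector space complement $V$ of $A$ in $B$ (so $\dim_k V=m$). Every $\psi\in\mathrm{Gal}(B/A)$ is uniquely of the form $\psi(a+x)=a+r(x)+\sigma(x)$ for all $a\in A$, $x\in V$, where $r\in\mathrm{Hom}_k(V,A)$ and $\sigma\in\mathrm{GL}_k(V)$ is a linear automorphism of $V$; the embedding sends $\psi$ to the pair $(r,\sigma)$, where $\mathrm{Hom}_k(V,A)$ and $\mathrm{GL}_k(V)$ are identified with $\mathrm{M}_{n\times m}(k)$ and $\mathrm{GL}(m,k)$ by choosing bases of $A$ and $V$. *)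

theory Defs
  imports "HOL-Algebra.Group" "Jordan_Normal_Form.Matrix"
begin

text \<open>A unital associative algebra over a field: the unital associative ring structure comes from
  the type class, the scalar multiplication is the locale parameter.\<close>

locale assoc_algebra = vector_space scale
  for scale :: "'k::field \<Rightarrow> 'b::ring_1 \<Rightarrow> 'b" (infixr \<open>*s\<close> 75) +
  assumes scale_mult_left: "(c *s x) * y = c *s (x * y)"
    and scale_mult_right: "x * (c *s y) = c *s (x * y)"
begin

text \<open>An extension of unital algebras shares its unit.\<close>

definition subalgebra :: "'b set \<Rightarrow> bool" where
  "subalgebra A \<longleftrightarrow> subspace A \<and> 1 \<in> A \<and> (\<forall>x\<in>A. \<forall>y\<in>A. x * y \<in> A)"

definition algebra_aut :: "('b \<Rightarrow> 'b) \<Rightarrow> bool" where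
  "algebra_aut \<psi> \<longleftrightarrow> Vector_Spaces.linear scale scale \<psi> \<and> bij \<psi> \<and>
     (\<forall>x y. \<psi> (x * y) = \<psi> x * \<psi> y) \<and> \<psi> 1 = 1"

definition Gal :: "'b set \<Rightarrow> ('b \<Rightarrow> 'b) monoid" where
  "Gal A = \<lparr>carrier = {\<psi>. algebra_aut \<psi> \<and> (\<forall>a\<in>A. \<psi> a = a)}, mult = (\<circ>), one = id\<rparr>"

definition complement :: "'b set \<Rightarrow> 'b set \<Rightarrow> bool" where
  "complement A V \<longleftrightarrow> subspace V \<and> A \<inter> V = {0} \<and> (\<forall>b. \<exists>a\<in>A. \<exists>x\<in>V. b = a + x)"

definition ordered_basis :: "'b set \<Rightarrow> 'b list \<Rightarrow> bool" where
  "ordered_basis W bs \<longleftrightarrow> distinct bs \<and> independent (set bs) \<and> span (set bs) = W"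

text \<open>Maps defined on a subspace \<open>V\<close> are represented by functions that are \<open>undefined\<close> outside
  \<open>V\<close>, so that equality of functions is equality on \<open>V\<close>.\<close>

definition Hom_on :: "'b set \<Rightarrow> 'b set \<Rightarrow> ('b \<Rightarrow> 'b) set" where
  "Hom_on V W = {f \<in> V \<rightarrow>\<^sub>E W. (\<forall>x\<in>V. \<forall>y\<in>V. f (x + y) = f x + f y) \<and>
     (\<forall>c. \<forall>x\<in>V. f (c *s x) = c *s f x)}"

definition GL_on :: "'b set \<Rightarrow> ('b \<Rightarrow> 'b) set" where
  "GL_on V = {f \<in> Hom_on V V. bij_betw f V V}"

definition is_pair_of :: "'b set \<Rightarrow> 'b set \<Rightarrow> ('b \<Rightarrow> 'b) \<Rightarrow> ('b \<Rightarrow> 'b) \<times> ('b \<Rightarrow> 'b) \<Rightarrow> bool" where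
  "is_pair_of A V \<psi> p \<longleftrightarrow> fst p \<in> Hom_on V A \<and> snd p \<in> GL_on V \<and>
     (\<forall>a\<in>A. \<forall>x\<in>V. \<psi> (a + x) = a + fst p x + snd p x)"

text \<open>Column convention: column \<open>j\<close> holds the coordinates of the image of the \<open>j\<close>-th vector of
  \<open>vs\<close> with respect to \<open>ws\<close>.\<close>

definition matrix_of :: "'b list \<Rightarrow> 'b list \<Rightarrow> ('b \<Rightarrow> 'b) \<Rightarrow> 'k mat" where
  "matrix_of vs ws f = mat (length ws) (length vs) (\<lambda>(i, j). representation (set ws) (f (vs ! j)) (ws ! i))"

text \<open>The canonical embedding for the complement \<open>V\<close>, in the bases \<open>es\<close> of \<open>A\<close> and \<open>vs\<close> of \<open>V\<close>.\<close>

definition canonical_embedding ::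
  "'b set \<Rightarrow> 'b set \<Rightarrow> 'b list \<Rightarrow> 'b list \<Rightarrow> ('b \<Rightarrow> 'b) \<Rightarrow> 'k mat \<times> 'k mat" where
  "canonical_embedding A V es vs \<psi> =
     (let p = (THE p. is_pair_of A V \<psi> p)
      in (matrix_of vs es (fst p), matrix_of vs vs (snd p)))"

end

text \<open>The semidirect product of \<open>GL(m, k)\<close> and the additive group of \<open>n \<times> m\<close> matrices, in the right
  hand side convention.\<close>

definition GL_semidirect :: "nat \<Rightarrow> nat \<Rightarrow> ('k::field mat \<times> 'k mat) monoid" where
  "GL_semidirect m n =
     \<lparr>carrier = carrier_mat n m \<times> {S \<in> carrier_mat m m. invertible_mat S},
      mult = (\<lambda>(R, S) (R', S'). (R' + R * S', S * S')),
      one = (0\<^sub>m n m, 1\<^sub>m m)\<rparr>"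

end

theory Submission
  imports Defs
begin

text \<open>Relative to \<open>B = A \<oplus> V\<close>, an automorphism fixing \<open>A\<close> is block triangular: it is determined by its
  restriction to \<open>V\<close>, whose two components are \<open>r : V \<rightarrow> A\<close> and \<open>\<sigma> : V \<rightarrow> V\<close>. Evaluating a composite on
  \<open>x \<in> V\<close> gives \<open>\<psi> (r' x + \<sigma>' x) = r' x + r (\<sigma>' x) + \<sigma> (\<sigma>' x)\<close>, because \<open>\<psi>\<close> fixes \<open>r' x \<in> A\<close>; this is
  the group law of the semidirect product. If \<open>\<sigma> x = 0\<close> then \<open>\<psi> x = r x = \<psi> (r x)\<close>, so
  \<open>x \<in> A \<inter> V = {0}\<close>; applying the decomposition to \<open>\<psi>\<inverse> y\<close> shows that \<open>\<sigma>\<close> is onto.\<close>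

section \<open>Invertible matrices and the semidirect product\<close>

text \<open>\<open>invertible_mat\<close> leaves the shape of the inverse open. Comparing dimensions
  in the two products forces it to be \<open>m\<close> by \<open>m\<close>, which the matrix algebra
  below relies on.\<close>

lemma invertible_mat_iff:
  assumes "S \<in> carrier_mat m m"
  shows "invertible_mat S \<longleftrightarrow> (\<exists>T\<in>carrier_mat m m. S * T = 1\<^sub>m m \<and> T * S = 1\<^sub>m m)"
proof
  assume "invertible_mat S"
  then obtain T where "S * T = 1\<^sub>m m" "T * S = 1\<^sub>m (dim_row T)"
    using assms by (auto simp: invertible_mat_def inverts_mat_def)
  moreover from this assms have "T \<in> carrier_mat m m"
    by (metis carrier_matD(2) carrier_matI index_mult_mat(2,3) index_one_mat(2,3))
  ultimately show "\<exists>T\<in>carrier_mat m m. S * T = 1\<^sub>m m \<and> T * S = 1\<^sub>m m" by auto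
qed (use assms in \<open>auto simp: invertible_mat_def inverts_mat_def\<close>)

lemma invertible_mat_mult:
  assumes "S \<in> carrier_mat m m" "S' \<in> carrier_mat m m" "invertible_mat S" "invertible_mat S'"
  shows "invertible_mat (S * S')"
proof -
  obtain T T' where T: "T \<in> carrier_mat m m" "S * T = 1\<^sub>m m" "T * S = 1\<^sub>m m"
    and T': "T' \<in> carrier_mat m m" "S' * T' = 1\<^sub>m m" "T' * S' = 1\<^sub>m m"
    using assms invertible_mat_iff by metis
  have "(S * S') * (T' * T) = S * ((S' * T') * T)" "(T' * T) * (S * S') = T' * ((T * S) * S')"
    using assms(1,2) T(1) T'(1) by (simp_all add: assoc_mult_mat[of _ m m _ m _ m])
  then have "(S * S') * (T' * T) = 1\<^sub>m m" "(T' * T) * (S * S') = 1\<^sub>m m"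
    by (simp_all only: T T' left_mult_one_mat[OF T(1)] left_mult_one_mat[OF assms(2)])
  then show ?thesis
    using assms T T' invertible_mat_iff[of "S * S'" m] by (meson mult_carrier_mat)
qed

lemma group_GL_semidirect:
  "group (GL_semidirect m n :: ('k::field mat \<times> 'k mat) monoid)" (is "group ?G")
proof (rule groupI)
  show "\<one>\<^bsub>?G\<^esub> \<in> carrier ?G"
    by (auto simp: GL_semidirect_def invertible_mat_def inverts_mat_def intro!: exI[of _ "1\<^sub>m m"])
next
  fix x y assume "x \<in> carrier ?G" "y \<in> carrier ?G"
  then obtain R S R' S' where xy: "x = (R, S)" "y = (R', S')"
    and c: "R \<in> carrier_mat n m" "S \<in> carrier_mat m m" "R' \<in> carrier_mat n m" "S' \<in> carrier_mat m m"
    and inv: "invertible_mat S" "invertible_mat S'"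
    by (auto simp: GL_semidirect_def)
  show "x \<otimes>\<^bsub>?G\<^esub> y \<in> carrier ?G"
    using c invertible_mat_mult[OF c(2,4) inv] by (simp add: GL_semidirect_def xy)
next
  fix x y z assume "x \<in> carrier ?G" "y \<in> carrier ?G" "z \<in> carrier ?G"
  then obtain R S R' S' R'' S'' where xyz: "x = (R, S)" "y = (R', S')" "z = (R'', S'')"
    and c: "R \<in> carrier_mat n m" "S \<in> carrier_mat m m" "R' \<in> carrier_mat n m" "S' \<in> carrier_mat m m"
      "R'' \<in> carrier_mat n m" "S'' \<in> carrier_mat m m"
    by (auto simp: GL_semidirect_def)
  show "x \<otimes>\<^bsub>?G\<^esub> y \<otimes>\<^bsub>?G\<^esub> z = x \<otimes>\<^bsub>?G\<^esub> (y \<otimes>\<^bsub>?G\<^esub> z)"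
    using c by (simp add: GL_semidirect_def xyz add_mult_distrib_mat[of _ n m])
next
  fix x assume "x \<in> carrier ?G"
  then show "\<one>\<^bsub>?G\<^esub> \<otimes>\<^bsub>?G\<^esub> x = x"
    by (auto simp: GL_semidirect_def)
next
  fix x assume "x \<in> carrier ?G"
  then obtain R S where x: "x = (R, S)"
    and c: "R \<in> carrier_mat n m" "S \<in> carrier_mat m m" and inv: "invertible_mat S"
    by (auto simp: GL_semidirect_def)
  then obtain T where T: "T \<in> carrier_mat m m" and ST: "S * T = 1\<^sub>m m" "T * S = 1\<^sub>m m"
    using invertible_mat_iff by blast
  have "invertible_mat T"
    using T c ST invertible_mat_iff by blast
  \<comment> \<open>A left inverse \<open>(X, Y)\<close> must satisfy \<open>R + X * S = 0\<close>
    and \<open>Y * S = 1\<close>. With \<open>T\<close> inverse to \<open>S\<close> this gives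
    \<open>Y = T\<close> and \<open>X = - (R * T)\<close>.\<close>
  moreover have "- (R * T) * S = - R"
    using c T ST by (simp add: assoc_mult_mat[of _ n m _ m _ m] uminus_mult_left_mat)
  ultimately show "\<exists>y\<in>carrier ?G. y \<otimes>\<^bsub>?G\<^esub> x = \<one>\<^bsub>?G\<^esub>"
    using c T ST
    by (intro bexI[of _ "(- (R * T), T)"])
      (auto simp: GL_semidirect_def x)
qed

context assoc_algebra
begin

section \<open>The Galois group\<close>

lemma group_Gal: "group (Gal A)"
proof (rule groupI)
  show "\<one>\<^bsub>Gal A\<^esub> \<in> carrier (Gal A)"
    by (simp add: Gal_def algebra_aut_def linear_id)
next
  fix x y assume "x \<in> carrier (Gal A)" "y \<in> carrier (Gal A)"
  then show "x \<otimes>\<^bsub>Gal A\<^esub> y \<in> carrier (Gal A)"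
    by (auto simp: Gal_def algebra_aut_def bij_comp intro: Vector_Spaces.linear_compose)
next
  fix x y z
  show "x \<otimes>\<^bsub>Gal A\<^esub> y \<otimes>\<^bsub>Gal A\<^esub> z = x \<otimes>\<^bsub>Gal A\<^esub> (y \<otimes>\<^bsub>Gal A\<^esub> z)"
    by (simp add: Gal_def o_assoc)
next
  fix x
  show "\<one>\<^bsub>Gal A\<^esub> \<otimes>\<^bsub>Gal A\<^esub> x = x" by (simp add: Gal_def)
next
  fix f assume "f \<in> carrier (Gal A)"
  then have f: "\<And>x y. f (x + y) = f x + f y" "\<And>c x. f (c *s x) = c *s f x"
    "\<And>x y. f (x * y) = f x * f y" "f 1 = 1" "bij f" "\<And>a. a \<in> A \<Longrightarrow> f a = a"
    by (auto simp: Gal_def algebra_aut_def Vector_Spaces.linear_iff)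
  define g where "g = inv_into UNIV f"
  have g: "f (g y) = y" "g (f y) = y" for y
    using f(5) by (simp_all add: g_def bij_is_surj bij_is_inj surj_f_inv_f)
  \<comment> \<open>Each property of the inverse \<open>g\<close> is thereby reduced to the
    corresponding property of \<open>f\<close>.\<close>
  have gI: "g y = x" if "f x = y" for x y using that g by auto
  have "algebra_aut g" "\<forall>a\<in>A. g a = a"
    unfolding algebra_aut_def Vector_Spaces.linear_iff
    using bij_imp_bij_inv[OF f(5)] by (auto simp: f g g_def[symmetric] vector_space_axioms intro!: gI)
  then show "\<exists>g\<in>carrier (Gal A). g \<otimes>\<^bsub>Gal A\<^esub> f = \<one>\<^bsub>Gal A\<^esub>"
    by (intro bexI[of _ g]) (auto simp: Gal_def g)
qed

section \<open>Complements, bases and dimensions\<close>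

lemma ordered_basis_exists:
  assumes "independent B" "finite B"
  shows "\<exists>bs. ordered_basis (span B) bs"
  using finite_distinct_list[OF assms(2)] assms(1) by (auto simp: ordered_basis_def)

text \<open>A vector in both spans has one coordinate function with respect to \<open>C\<close>. Its
  support lies in \<open>B\<close> and in \<open>D\<close>, hence is empty.\<close>

lemma span_Int_disjoint_independent:
  assumes "independent C" "B \<subseteq> C" "D \<subseteq> C" "B \<inter> D = {}"
  shows "span B \<inter> span D = {0}"
proof -
  have "x = 0" if x: "x \<in> span B" "x \<in> span D" for x
  proof -
    have "representation B x = representation D x"
      using representation_extend[OF assms(1) x(1) assms(2)]
        representation_extend[OF assms(1) x(2) assms(3)] by simp
    then have "representation B x b = 0" for b
      using representation_ne_zero[of B x b] representation_ne_zero[of D x b] assms(4) by force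
    then show "x = 0"
      using sum_nonzero_representation_eq[OF independent_mono[OF assms(1,2)] x(1)] by simp
  qed
  then show ?thesis by (auto simp: span_zero)
qed

text \<open>A basis \<open>B\<close> of \<open>A\<close> is extended to a basis \<open>D\<close> of
  the whole algebra; the added vectors \<open>D - B\<close> span the complement. The finite spanning
  set \<open>C\<close> bounds \<open>D\<close>, so both bases can be listed.\<close>

lemma complement_exists:
  assumes A: "subspace A" and C: "finite C" "span C = UNIV"
  shows "\<exists>V es vs. complement A V \<and> ordered_basis A es \<and> ordered_basis V vs"
proof -
  obtain B where B: "B \<subseteq> A" "independent B" "A \<subseteq> span B"
    using maximal_independent_subset by blast
  have AB: "A = span B"
    using B A span_minimal[of B A] by auto
  obtain D where D: "B \<subseteq> D" "independent D" "UNIV \<subseteq> span D"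
    using maximal_independent_subset_extend[of B UNIV] B by auto
  have "finite D" using independent_span_bound[of C D] C D by auto
  then have fin: "finite B" "finite (D - B)" using D by (auto intro: finite_subset)
  have ind: "independent (D - B)" using D independent_mono by blast
  have "\<exists>a\<in>span B. \<exists>x\<in>span (D - B). b = a + x" for b
  proof -
    have "b \<in> span (B \<union> (D - B))" using D(1,3) by (metis Diff_partition UNIV_I subsetD)
    then show ?thesis unfolding span_Un by auto
  qed
  then have "complement A (span (D - B))"
    unfolding complement_def AB
    using span_Int_disjoint_independent[of D B "D - B"] D by auto
  moreover obtain es where "ordered_basis A es"
    using ordered_basis_exists[OF B(2) fin(1)] AB by auto
  moreover obtain vs where "ordered_basis (span (D - B)) vs"
    using ordered_basis_exists[OF ind fin(2)] by auto
  ultimately show ?thesis by blast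
qed

lemma length_ordered_basis:
  "ordered_basis W bs \<Longrightarrow> length bs = dim W"
  by (metis distinct_card dim_span_eq_card_independent ordered_basis_def)

lemma dim_complement:
  assumes "subspace A" "complement A V" "finite C" "independent C" "span C = UNIV"
  shows "dim A + dim V = dim UNIV"
proof -
  \<comment> \<open>The basis \<open>C\<close> gives access to the dimension formula for a sum of
    subspaces, applied here with intersection \<open>{0}\<close>.\<close>
  interpret finite_dimensional_vector_space scale C
    using assms by unfold_locales auto
  have "{x + y |x y. x \<in> A \<and> y \<in> V} = UNIV"
    using assms(2) unfolding complement_def by blast
  then show ?thesis
    using dim_sums_Int[of A V] assms(1,2) by (simp add: complement_def)
qed

section \<open>Linear maps between subspaces and their matrices\<close>

lemma Hom_onD:
  assumes "f \<in> Hom_on V W"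
  shows "x \<in> V \<Longrightarrow> f x \<in> W" "x \<in> V \<Longrightarrow> y \<in> V \<Longrightarrow> f (x + y) = f x + f y"
    "x \<in> V \<Longrightarrow> f (c *s x) = c *s f x" "f \<in> extensional V"
  using assms by (auto simp: Hom_on_def PiE_def)

lemma Hom_on_sum:
  assumes f: "f \<in> Hom_on V W" and V: "subspace V" and I: "\<And>i. i \<in> I \<Longrightarrow> u i \<in> V"
  shows "f (\<Sum>i\<in>I. c i *s u i) = (\<Sum>i\<in>I. c i *s f (u i))"
proof -
  \<comment> \<open>This settles the empty sum, and also an infinite \<open>I\<close>, where both
    sums are \<open>0\<close> by convention.\<close>
  have "f 0 = 0"
    using Hom_onD(3)[OF f, of 0 0] subspace_0[OF V] by simp
  then show ?thesis
    using I
  proof (induction I rule: infinite_finite_induct)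
    case (insert j I)
    then have "(\<Sum>i\<in>I. c i *s u i) \<in> V" "c j *s u j \<in> V"
      using V by (auto intro!: subspace_sum subspace_scale)
    then show ?case
      using insert by (simp add: Hom_onD[OF f])
  qed auto
qed

text \<open>On the span, linearity carries agreement over from \<open>B\<close>; off the span both
  maps are \<open>undefined\<close>. This yields equality of functions.\<close>

lemma Hom_on_eqI:
  assumes "f \<in> Hom_on (span B) W" "g \<in> Hom_on (span B) W" "finite B" "\<And>b. b \<in> B \<Longrightarrow> f b = g b"
  shows "f = g"
proof
  fix x
  show "f x = g x"
  proof (cases "x \<in> span B")
    case True
    then obtain c where "x = (\<Sum>b\<in>B. c b *s b)"
      using span_finite[OF assms(3)] by auto
    then show ?thesis
      using Hom_on_sum[OF assms(1) subspace_span, of B "\<lambda>b. b" c]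
        Hom_on_sum[OF assms(2) subspace_span, of B "\<lambda>b. b" c] assms(4) by (simp add: span_base)
  next
    case False
    then show ?thesis
      using Hom_onD(4)[OF assms(1)] Hom_onD(4)[OF assms(2)] by (simp add: extensional_def)
  qed
qed

lemma matrix_of_carrier [simp]: "matrix_of vs ws f \<in> carrier_mat (length ws) (length vs)"
  by (simp add: matrix_of_def)

text \<open>The columns are the coordinates of the images of the basis vectors, so equal matrices
  mean agreement on a basis.\<close>

lemma matrix_of_inj:
  assumes V: "ordered_basis V vs" and W: "ordered_basis W ws"
    and f: "f \<in> Hom_on V W" and g: "g \<in> Hom_on V W"
    and eq: "matrix_of vs ws f = matrix_of vs ws g"
  shows "f = g"
proof -
  have sp: "V = span (set vs)" "W = span (set ws)" and ind: "independent (set ws)"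
    using V W by (auto simp: ordered_basis_def)
  have "f b = g b" if b: "b \<in> set vs" for b
  proof -
    obtain j where j: "j < length vs" "b = vs ! j" using b by (metis in_set_conv_nth)
    have "representation (set ws) (f b) w = representation (set ws) (g b) w" if w: "w \<in> set ws" for w
    proof -
      obtain i where i: "i < length ws" "w = ws ! i" using w by (metis in_set_conv_nth)
      have "matrix_of vs ws f $$ (i, j) = matrix_of vs ws g $$ (i, j)" by (simp only: eq)
      then show ?thesis using i j by (simp add: matrix_of_def)
    qed
    then have "(\<Sum>w\<in>set ws. representation (set ws) (f b) w *s w) =
        (\<Sum>w\<in>set ws. representation (set ws) (g b) w *s w)"
      by (intro sum.cong) simp_all
    moreover have "f b \<in> span (set ws)" "g b \<in> span (set ws)"
      using b Hom_onD(1)[OF f] Hom_onD(1)[OF g] sp by (simp_all add: span_base)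
    ultimately show "f b = g b"
      using sum_representation_eq[OF ind, of _ "set ws"] by simp
  qed
  then show ?thesis
    using Hom_on_eqI[of f "set vs" W g] f g sp by auto
qed

text \<open>\<open>matrix_of\<close> evaluates its argument at basis vectors of \<open>V\<close>
  alone, so \<open>h\<close> is specified by its values on \<open>V\<close>; any representative of
  the sum fits.\<close>

lemma matrix_of_add:
  assumes V: "ordered_basis V vs" and W: "ordered_basis W ws"
    and f: "f \<in> Hom_on V W" and g: "g \<in> Hom_on V W"
    and h: "\<And>x. x \<in> V \<Longrightarrow> h x = f x + g x"
  shows "matrix_of vs ws h = matrix_of vs ws f + matrix_of vs ws g"
proof (rule eq_matI)
  fix i j assume "i < dim_row (matrix_of vs ws f + matrix_of vs ws g)"
    "j < dim_col (matrix_of vs ws f + matrix_of vs ws g)"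
  then have ij: "i < length ws" "j < length vs" by (auto simp: matrix_of_def)
  then have v: "vs ! j \<in> V" using V by (auto simp: ordered_basis_def span_base)
  then have "f (vs ! j) \<in> span (set ws)" "g (vs ! j) \<in> span (set ws)"
    using Hom_onD(1)[OF f] Hom_onD(1)[OF g] W by (auto simp: ordered_basis_def)
  then show "matrix_of vs ws h $$ (i, j) = (matrix_of vs ws f + matrix_of vs ws g) $$ (i, j)"
    using ij W by (simp add: matrix_of_def h[OF v] representation_add ordered_basis_def)
qed (simp_all add: matrix_of_def)

lemma matrix_of_comp:
  assumes V: "ordered_basis V vs" and W: "ordered_basis W ws" and U: "ordered_basis U us"
    and f: "f \<in> Hom_on W U" and g: "g \<in> Hom_on V W"
    and h: "\<And>x. x \<in> V \<Longrightarrow> h x = f (g x)"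
  shows "matrix_of vs us h = matrix_of ws us f * matrix_of vs ws g"
proof (rule eq_matI)
  fix i j assume "i < dim_row (matrix_of ws us f * matrix_of vs ws g)"
    "j < dim_col (matrix_of ws us f * matrix_of vs ws g)"
  then have ij: "i < length us" "j < length vs" by (auto simp: matrix_of_def)
  then have v: "vs ! j \<in> V" using V by (auto simp: ordered_basis_def span_base)
  have W': "distinct ws" "independent (set ws)" "span (set ws) = W"
    and U': "independent (set us)" "span (set us) = U"
    using W U by (auto simp: ordered_basis_def)
  \<comment> \<open>The coordinates of the image of the \<open>j\<close>-th basis vector, that is,
    column \<open>j\<close> of the matrix of \<open>g\<close>. Applying \<open>f\<close> to this
    expansion gives the matrix product.\<close>
  define c where "c = representation (set ws) (g (vs ! j))"
  have "g (vs ! j) = (\<Sum>w\<in>set ws. c w *s w)"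
    unfolding c_def using sum_representation_eq[OF W'(2)] W'(3) Hom_onD(1)[OF g v] by simp
  then have hv: "h (vs ! j) = (\<Sum>w\<in>set ws. c w *s f w)"
    using Hom_on_sum[OF f, of "set ws" "\<lambda>w. w" c] h[OF v] W' by (auto simp: span_base)
  have fw: "f w \<in> span (set us)" if "w \<in> set ws" for w
    using Hom_onD(1)[OF f, of w] W' U' that by (auto simp: span_base)
  from fw have "representation (set us) (\<Sum>w\<in>set ws. c w *s f w) (us ! i) =
      (\<Sum>w\<in>set ws. representation (set us) (c w *s f w) (us ! i))"
    by (subst representation_sum[OF U'(1)]) (auto intro: span_scale)
  with hv have "representation (set us) (h (vs ! j)) (us ! i) =
      (\<Sum>w\<in>set ws. c w * representation (set us) (f w) (us ! i))"
    by (simp add: representation_scale[OF U'(1) fw])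
  \<comment> \<open>Distinctness of \<open>ws\<close> turns the sum over basis vectors into a sum
    over indices, the form of the scalar product of a row and a column.\<close>
  also have "\<dots> = (\<Sum>k<length ws. c (ws ! k) * representation (set us) (f (ws ! k)) (us ! i))"
    by (rule sum.reindex_bij_betw[OF bij_betw_nth, symmetric]) (simp_all add: W')
  finally show "matrix_of vs us h $$ (i, j) = (matrix_of ws us f * matrix_of vs ws g) $$ (i, j)"
    using ij by (simp add: matrix_of_def scalar_prod_def c_def lessThan_atLeast0 mult.commute)
qed (simp_all add: matrix_of_def)

lemma matrix_of_id:
  assumes V: "ordered_basis V vs" and h: "\<And>x. x \<in> V \<Longrightarrow> h x = x"
  shows "matrix_of vs vs h = 1\<^sub>m (length vs)"
proof (rule eq_matI)
  fix i j assume "i < dim_row (1\<^sub>m (length vs))" "j < dim_col (1\<^sub>m (length vs))"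
  then have ij: "i < length vs" "j < length vs" by auto
  then have "h (vs ! j) = vs ! j"
    using V h[of "vs ! j"] by (auto simp: ordered_basis_def span_base)
  then show "matrix_of vs vs h $$ (i, j) = 1\<^sub>m (length vs) $$ (i, j)"
    using ij V by (auto simp: matrix_of_def representation_basis ordered_basis_def nth_eq_iff_index_eq)
qed (simp_all add: matrix_of_def)

text \<open>The inverse matrix is the matrix of the inverse map, since \<open>matrix_of\<close>
  takes composites to products.\<close>

lemma invertible_matrix_of:
  assumes V: "ordered_basis V vs" and f: "f \<in> GL_on V"
  shows "invertible_mat (matrix_of vs vs f)"
proof -
  have fH: "f \<in> Hom_on V V" and bij: "bij_betw f V V" using f by (auto simp: GL_on_def)
  have subV: "subspace V" using V by (auto simp: ordered_basis_def)
  \<comment> \<open>The restriction makes \<open>g\<close> \<open>undefined\<close> off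
    \<open>V\<close>, as membership in \<open>Hom_on V V\<close> demands.\<close>
  define g where "g = restrict (the_inv_into V f) V"
  have fg: "f (g y) = y" "g y \<in> V" if "y \<in> V" for y
    using that bij by (auto simp: g_def bij_betw_def f_the_inv_into_f intro: the_inv_into_into)
  have gf: "g (f x) = x" if "x \<in> V" for x
    using that bij Hom_onD(1)[OF fH that] by (auto simp: g_def bij_betw_def the_inv_into_f_f)
  \<comment> \<open>By linearity \<open>f\<close> sends \<open>g x + g y\<close> to
    \<open>x + y\<close>; applying \<open>g\<close> to both sides gives additivity. Scaling works
    the same way.\<close>
  have "g (x + y) = g x + g y" if "x \<in> V" "y \<in> V" for x y
    using gf[of "g x + g y"] that fg Hom_onD(2)[OF fH] subspace_add[OF subV] by simp
  moreover have "g (c *s x) = c *s g x" if "x \<in> V" for c x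
    using gf[of "c *s g x"] that fg Hom_onD(3)[OF fH] subspace_scale[OF subV] by simp
  ultimately have gH: "g \<in> Hom_on V V"
    using fg(2) by (auto simp: Hom_on_def g_def)
  have "matrix_of vs vs f * matrix_of vs vs g = 1\<^sub>m (length vs)"
    using matrix_of_comp[OF V V V fH gH] matrix_of_id[OF V, of "\<lambda>x. f (g x)"] fg by simp
  moreover have "matrix_of vs vs g * matrix_of vs vs f = 1\<^sub>m (length vs)"
    using matrix_of_comp[OF V V V gH fH] matrix_of_id[OF V, of "\<lambda>x. g (f x)"] gf by simp
  ultimately show ?thesis
    unfolding invertible_mat_def inverts_mat_def
    by (intro conjI exI[of _ "matrix_of vs vs g"]) (simp_all add: matrix_of_def)
qed

section \<open>The pair attached to an automorphism\<close>

lemma complement_unique: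
  assumes A: "subspace A" and V: "complement A V"
    and mem: "a \<in> A" "a' \<in> A" "x \<in> V" "x' \<in> V" and eq: "a + x = a' + x'"
  shows "a = a'" "x = x'"
proof -
  have "a - a' = x' - x" using eq by (simp add: algebra_simps)
  moreover have "a - a' \<in> A" "x' - x \<in> V"
    using A V mem by (auto simp: complement_def intro: subspace_diff)
  ultimately have "a - a' \<in> A \<inter> V" by simp
  then have "a - a' = 0" using V by (simp only: complement_def singleton_iff)
  then show "a = a'" "x = x'" using eq by auto
qed

text \<open>Evaluating \<psi> at \<open>0 + x\<close> and comparing components determines both maps
  on \<open>V\<close>, and off \<open>V\<close> they are \<open>undefined\<close>. This justifies
  the \<open>THE\<close> in \<open>canonical_embedding\<close>.\<close>

lemma is_pair_of_unique:
  assumes A: "subspace A" and V: "complement A V"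
    and p: "is_pair_of A V \<psi> p" and q: "is_pair_of A V \<psi> q"
  shows "p = q"
proof -
  have H: "fst p \<in> Hom_on V A" "fst q \<in> Hom_on V A" "snd p \<in> Hom_on V V" "snd q \<in> Hom_on V V"
    using p q by (auto simp: is_pair_of_def GL_on_def)
  have 0: "0 \<in> A" using A by (rule subspace_0)
  have eq: "fst p x = fst q x" "snd p x = snd q x" if x: "x \<in> V" for x
  proof -
    have "\<psi> (0 + x) = 0 + fst p x + snd p x" "\<psi> (0 + x) = 0 + fst q x + snd q x"
      using p q x 0 unfolding is_pair_of_def by blast+
    then have "fst p x + snd p x = fst q x + snd q x" by simp
    then show "fst p x = fst q x" "snd p x = snd q x"
      using complement_unique[OF A V] H[THEN Hom_onD(1)[OF _ x]] by blast+
  qed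
  have "fst p = fst q" "snd p = snd q"
    by (rule extensionalityI[of _ V]; use H eq in \<open>simp add: Hom_onD(4)\<close>)+
  then show ?thesis by (simp add: prod_eq_iff)
qed

lemma is_pair_of_exists:
  assumes A: "subspace A" and V: "complement A V" and \<psi>: "\<psi> \<in> carrier (Gal A)"
  shows "\<exists>p. is_pair_of A V \<psi> p"
proof -
  have \<psi>_add: "\<psi> (x + y) = \<psi> x + \<psi> y" and \<psi>_scale: "\<psi> (c *s x) = c *s \<psi> x" for x y c
    using \<psi> by (auto simp: Gal_def algebra_aut_def Vector_Spaces.linear_iff)
  have bij: "bij \<psi>" and \<psi>_A: "\<And>a. a \<in> A \<Longrightarrow> \<psi> a = a"
    using \<psi> by (auto simp: Gal_def algebra_aut_def)
  have subV: "subspace V" using V by (simp add: complement_def)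
  have dec: "\<forall>b. \<exists>p. fst p \<in> A \<and> snd p \<in> V \<and> b = fst p + snd p"
    using V unfolding complement_def by (metis fst_conv snd_conv)
  \<comment> \<open>\<open>P\<close> gives the components of a vector in \<open>A\<close> and
    \<open>V\<close>; the pair is read off from \<open>P\<close> applied to \<psi> on
    \<open>V\<close>.\<close>
  from choice[OF dec] obtain P where
    P: "\<And>b. fst (P b) \<in> A" "\<And>b. snd (P b) \<in> V" "\<And>b. b = fst (P b) + snd (P b)" by blast
  define r where "r = restrict (\<lambda>x. fst (P (\<psi> x))) V"
  define \<sigma> where "\<sigma> = restrict (\<lambda>x. snd (P (\<psi> x))) V"
  have rs: "r x \<in> A" "\<sigma> x \<in> V" "\<psi> x = r x + \<sigma> x" if "x \<in> V" for x
    using that P by (auto simp: r_def \<sigma>_def)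
  \<comment> \<open>Any decomposition of \<open>\<psi> x\<close> identifies \<open>r x\<close> and
    \<open>\<sigma> x\<close>. Linearity of both maps follows by exhibiting the evident
    decomposition.\<close>
  have rsI: "r x = a \<and> \<sigma> x = y" if "x \<in> V" "a \<in> A" "y \<in> V" "\<psi> x = a + y" for x a y
    using complement_unique[OF A V] that rs[OF that(1)] by metis
  have add: "r (x + y) = r x + r y \<and> \<sigma> (x + y) = \<sigma> x + \<sigma> y" if xy: "x \<in> V" "y \<in> V" for x y
    using rs[OF xy(1)] rs[OF xy(2)] subspace_add[OF subV] subspace_add[OF A] xy
    by (intro rsI) (auto simp: \<psi>_add algebra_simps)
  have scl: "r (c *s x) = c *s r x \<and> \<sigma> (c *s x) = c *s \<sigma> x" if x: "x \<in> V" for c x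
    using rs[OF x] subspace_scale[OF subV] subspace_scale[OF A] x
    by (intro rsI) (auto simp: \<psi>_scale scale_right_distrib)
  have ext: "r \<in> extensional V" "\<sigma> \<in> extensional V"
    by (simp_all add: r_def \<sigma>_def)
  have rH: "r \<in> Hom_on V A" and sH: "\<sigma> \<in> Hom_on V V"
    using rs(1,2) add scl ext by (auto simp: Hom_on_def PiE_def)
  have "bij_betw \<sigma> V V"
  proof (rule bij_betw_imageI)
    show "inj_on \<sigma> V"
    proof (rule inj_onI)
      fix x y assume xy: "x \<in> V" "y \<in> V" "\<sigma> x = \<sigma> y"
      \<comment> \<open>Crossing over the \<open>A\<close>-parts makes both sides equal to
        \<open>r x + r y + \<sigma> x\<close>. Injectivity of \<psi> and uniqueness of components
        then give \<open>x = y\<close>.\<close>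
      have "\<psi> (r y + x) = \<psi> (r x + y)"
        using rs[OF xy(1)] rs[OF xy(2)] xy(3) by (simp add: \<psi>_add \<psi>_A algebra_simps)
      then have "r y + x = r x + y" using bij by (simp add: bij_def inj_eq)
      then show "x = y" using complement_unique[OF A V] rs xy by blast
    qed
    show "\<sigma> ` V = V"
    proof
      show "\<sigma> ` V \<subseteq> V" using rs by auto
      show "V \<subseteq> \<sigma> ` V"
      proof
        fix y assume y: "y \<in> V"
        \<comment> \<open>The \<open>V\<close>-component of the preimage \<open>b\<close> is the
          vector that \<sigma> sends to \<open>y\<close>: the \<open>V\<close>-component of
          \<open>\<psi> b\<close> is \<open>\<sigma> x\<close>, while that of \<open>y\<close> is
          \<open>y\<close> itself.\<close>
        obtain b where b: "\<psi> b = y" using bij by (metis bij_pointE)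
        define a x where "a = fst (P b)" and "x = snd (P b)"
        have ax: "a \<in> A" "x \<in> V" "b = a + x" using P[of b] by (auto simp: a_def x_def)
        have "\<psi> b = (a + r x) + \<sigma> x"
          using rs[OF ax(2)] by (simp add: ax(3) \<psi>_add \<psi>_A[OF ax(1)] add.assoc)
        then have "(a + r x) + \<sigma> x = 0 + y" using b by simp
        then have "\<sigma> x = y"
          using complement_unique(2)[OF A V] rs[OF ax(2)] y ax(1) subspace_add[OF A] subspace_0[OF A]
          by blast
        then show "y \<in> \<sigma> ` V" using ax(2) by blast
      qed
    qed
  qed
  then have "is_pair_of A V \<psi> (r, \<sigma>)"
    using rH sH rs by (simp add: is_pair_of_def GL_on_def \<psi>_add \<psi>_A add.assoc)
  then show ?thesis by blast
qed

section \<open>The canonical embedding\<close>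

lemma canonical_embedding_eq:
  assumes "subspace A" "complement A V" "is_pair_of A V \<psi> p"
  shows "canonical_embedding A V es vs \<psi> = (matrix_of vs es (fst p), matrix_of vs vs (snd p))"
proof -
  have "(THE p. is_pair_of A V \<psi> p) = p"
    using is_pair_of_unique[OF assms(1,2)] assms(3) by blast
  then show ?thesis by (simp add: canonical_embedding_def)
qed

text \<open>This is the semidirect group law before passing to matrices. The restricted lambda and
  \<open>compose V\<close> keep both components \<open>undefined\<close> off
  \<open>V\<close>.\<close>

lemma is_pair_of_comp:
  assumes A: "subspace A" and V: "complement A V"
    and p: "is_pair_of A V \<phi> (r, \<sigma>)" and q: "is_pair_of A V \<psi> (r', \<sigma>')"
  shows "is_pair_of A V (\<phi> \<circ> \<psi>) (\<lambda>x\<in>V. r' x + r (\<sigma>' x), compose V \<sigma> \<sigma>')"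
proof -
  have H: "r \<in> Hom_on V A" "\<sigma> \<in> Hom_on V V" "r' \<in> Hom_on V A" "\<sigma>' \<in> Hom_on V V"
    and bij: "bij_betw \<sigma> V V" "bij_betw \<sigma>' V V"
    and eq: "\<And>a x. a \<in> A \<Longrightarrow> x \<in> V \<Longrightarrow> \<phi> (a + x) = a + r x + \<sigma> x"
      "\<And>a x. a \<in> A \<Longrightarrow> x \<in> V \<Longrightarrow> \<psi> (a + x) = a + r' x + \<sigma>' x"
    using p q by (auto simp: is_pair_of_def GL_on_def)
  have subV: "subspace V" using V by (simp add: complement_def)
  note mem = H[THEN Hom_onD(1)] subspace_add[OF A] subspace_add[OF subV]
    subspace_scale[OF A] subspace_scale[OF subV]
  note lin = H[THEN Hom_onD(2)] H[THEN Hom_onD(3)]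
  have "(\<lambda>x\<in>V. r' x + r (\<sigma>' x)) \<in> Hom_on V A"
    by (auto simp: Hom_on_def mem lin scale_right_distrib algebra_simps)
  moreover have "compose V \<sigma> \<sigma>' \<in> Hom_on V V"
    by (auto simp: Hom_on_def compose_def mem lin)
  moreover have "bij_betw (compose V \<sigma> \<sigma>') V V"
    using bij by (rule bij_betw_compose[rotated])
  moreover have "\<phi> (\<psi> (a + x)) = a + (r' x + r (\<sigma>' x)) + \<sigma> (\<sigma>' x)" if "a \<in> A" "x \<in> V" for a x
    using that by (simp add: eq mem add.assoc[symmetric])
  ultimately show ?thesis
    by (simp add: is_pair_of_def GL_on_def compose_def)
qed

lemma canonical_embedding_hom:
  assumes A: "subspace A" and V: "complement A V"
    and es: "ordered_basis A es" and vs: "ordered_basis V vs"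
  shows "canonical_embedding A V es vs \<in> hom (Gal A) (GL_semidirect (length vs) (length es))"
proof (rule homI)
  fix \<psi> assume \<psi>: "\<psi> \<in> carrier (Gal A)"
  obtain p where p: "is_pair_of A V \<psi> p" using is_pair_of_exists[OF A V \<psi>] by blast
  then have "invertible_mat (matrix_of vs vs (snd p))"
    using invertible_matrix_of[OF vs] by (simp add: is_pair_of_def)
  then show "canonical_embedding A V es vs \<psi> \<in> carrier (GL_semidirect (length vs) (length es))"
    by (simp add: canonical_embedding_eq[OF A V p] GL_semidirect_def)
next
  fix \<phi> \<psi> assume "\<phi> \<in> carrier (Gal A)" "\<psi> \<in> carrier (Gal A)"
  then obtain r \<sigma> r' \<sigma>' where p: "is_pair_of A V \<phi> (r, \<sigma>)" and q: "is_pair_of A V \<psi> (r', \<sigma>')"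
    using is_pair_of_exists[OF A V] by (metis surj_pair)
  have H: "r \<in> Hom_on V A" "\<sigma> \<in> Hom_on V V" "r' \<in> Hom_on V A" "\<sigma>' \<in> Hom_on V V"
    using p q by (auto simp: is_pair_of_def GL_on_def)
  have subV: "subspace V" using V by (simp add: complement_def)
  \<comment> \<open>With the mixed term isolated as a linear map, the first component splits by
    \<open>matrix_of_add\<close>, and \<open>matrix_of_comp\<close> gives the product in the group
    law.\<close>
  have c: "(\<lambda>x\<in>V. r (\<sigma>' x)) \<in> Hom_on V A"
    using H[THEN Hom_onD(1)] H[THEN Hom_onD(2)] H[THEN Hom_onD(3)] subspace_add[OF subV] subspace_scale[OF subV]
    by (auto simp: Hom_on_def)
  have "matrix_of vs es (\<lambda>x\<in>V. r' x + r (\<sigma>' x)) = matrix_of vs es r' + matrix_of vs es r * matrix_of vs vs \<sigma>'"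
    using matrix_of_add[OF vs es H(3) c] matrix_of_comp[OF vs vs es H(1,4), of "\<lambda>x\<in>V. r (\<sigma>' x)"] by simp
  moreover have "matrix_of vs vs (compose V \<sigma> \<sigma>') = matrix_of vs vs \<sigma> * matrix_of vs vs \<sigma>'"
    using matrix_of_comp[OF vs vs vs H(2,4)] by (simp add: compose_def)
  ultimately show "canonical_embedding A V es vs (\<phi> \<otimes>\<^bsub>Gal A\<^esub> \<psi>) =
      canonical_embedding A V es vs \<phi> \<otimes>\<^bsub>GL_semidirect (length vs) (length es)\<^esub> canonical_embedding A V es vs \<psi>"
    using canonical_embedding_eq[OF A V is_pair_of_comp[OF A V p q], of es vs]
    by (simp add: canonical_embedding_eq[OF A V p] canonical_embedding_eq[OF A V q] Gal_def GL_semidirect_def)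
qed

text \<open>Equal matrices give equal pairs, and a pair determines the automorphism because every
  element is a sum from \<open>A\<close> and \<open>V\<close>.\<close>

lemma canonical_embedding_inj:
  assumes A: "subspace A" and V: "complement A V"
    and es: "ordered_basis A es" and vs: "ordered_basis V vs"
  shows "inj_on (canonical_embedding A V es vs) (carrier (Gal A))"
proof (rule inj_onI)
  fix \<phi> \<psi> assume "\<phi> \<in> carrier (Gal A)" "\<psi> \<in> carrier (Gal A)"
    and eq: "canonical_embedding A V es vs \<phi> = canonical_embedding A V es vs \<psi>"
  then obtain p q where p: "is_pair_of A V \<phi> p" and q: "is_pair_of A V \<psi> q"
    using is_pair_of_exists[OF A V] by metis
  have "fst p = fst q" "snd p = snd q"
    using eq p q matrix_of_inj[OF vs es, of "fst p" "fst q"] matrix_of_inj[OF vs vs, of "snd p" "snd q"]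
    by (auto simp: canonical_embedding_eq[OF A V p] canonical_embedding_eq[OF A V q] is_pair_of_def GL_on_def)
  show "\<phi> = \<psi>"
  proof
    fix b
    obtain a x where "a \<in> A" "x \<in> V" "b = a + x" using V unfolding complement_def by blast
    then show "\<phi> b = \<psi> b"
      using p q \<open>fst p = fst q\<close> \<open>snd p = snd q\<close> by (simp add: is_pair_of_def)
  qed
qed

end

theorem corollary2p2:
  fixes scale :: "'k::field \<Rightarrow> 'b::ring_1 \<Rightarrow> 'b"
    and A :: "'b set"
    and m n :: nat
  assumes "assoc_algebra scale"
    and "assoc_algebra.subalgebra scale A"
    and "m > 0" and "n > 0"
    and "vector_space.dim scale A = n"
    and "vector_space.dim scale (UNIV :: 'b set) = n + m"
  shows "group (assoc_algebra.Gal scale A) \<and>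
    group (GL_semidirect m n :: ('k mat \<times> 'k mat) monoid) \<and>
    (\<exists>V es vs. assoc_algebra.complement scale A V \<and>
       assoc_algebra.ordered_basis scale A es \<and> assoc_algebra.ordered_basis scale V vs) \<and>
    (\<forall>V es vs. assoc_algebra.complement scale A V \<and>
       assoc_algebra.ordered_basis scale A es \<and> assoc_algebra.ordered_basis scale V vs \<longrightarrow>
         (\<forall>\<psi> \<in> carrier (assoc_algebra.Gal scale A). \<exists>!p. assoc_algebra.is_pair_of scale A V \<psi> p) \<and>
         assoc_algebra.canonical_embedding scale A V es vs
           \<in> hom (assoc_algebra.Gal scale A) (GL_semidirect m n) \<and>
         inj_on (assoc_algebra.canonical_embedding scale A V es vs)
           (carrier (assoc_algebra.Gal scale A)))"
proof -
  interpret assoc_algebra scale by fact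
  have A: "subspace A" using assms(2) by (simp add: subalgebra_def)
  obtain C where "independent C" "UNIV \<subseteq> span C" "card C = dim UNIV"
    by (rule basis_exists[of UNIV])
  then have C: "independent C" "span C = UNIV" "card C = n + m"
    using assms(6) by auto
  \<comment> \<open>Infinite sets have cardinality \<open>0\<close>, so positivity of
    \<open>n + m\<close> rules out an infinite basis.\<close>
  have fin: "finite C" using C(3) assms(3) by (intro card_ge_0_finite) simp
  \<comment> \<open>The dimension formula gives \<open>dim V = m\<close>, so the matrix sizes agree
    with those of \<open>GL_semidirect m n\<close> for every choice of complement and bases.\<close>
  have len: "length es = n" "length vs = m"
    if "complement A V" "ordered_basis A es" "ordered_basis V vs" for V es vs
    using length_ordered_basis[OF that(2)] length_ordered_basis[OF that(3)]
      dim_complement[OF A that(1) fin C(1,2)] assms(5,6) by linarith+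
  have ex1: "\<exists>!p. is_pair_of A V \<psi> p" if "complement A V" "\<psi> \<in> carrier (Gal A)" for V \<psi>
    using is_pair_of_exists[OF A that] is_pair_of_unique[OF A that(1)] by blast
  show ?thesis
  proof (intro conjI allI impI ballI)
    show "group (Gal A)" by (rule group_Gal)
    show "group (GL_semidirect m n :: ('k mat \<times> 'k mat) monoid)" by (rule group_GL_semidirect)
    \<comment> \<open>Existence of these data keeps the universal claim about them from being
      vacuous.\<close>
    show "\<exists>V es vs. complement A V \<and> ordered_basis A es \<and> ordered_basis V vs"
      by (rule complement_exists[OF A fin C(2)])
  next
    fix V es vs
    assume *: "complement A V \<and> ordered_basis A es \<and> ordered_basis V vs"
    show "\<exists>!p. is_pair_of A V \<psi> p" if "\<psi> \<in> carrier (Gal A)" for \<psi>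
      using ex1 * that by blast
    show "canonical_embedding A V es vs \<in> hom (Gal A) (GL_semidirect m n)"
      using canonical_embedding_hom[OF A, of V es vs] len[of V es vs] * by simp
    show "inj_on (canonical_embedding A V es vs) (carrier (Gal A))"
      using canonical_embedding_inj[OF A] * by blast
  qed
qed

end
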